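(* Let $q\ge 2$ be an integer and let $\alpha_q$ be an affine plane of order $q$. Then $C_k \hookrightarrow \alpha_q$ for all integers $k$ with $3\le k\le q^2$.
   Context: A partial plane is an incidence structure of points and lines in which any two distinct points lie on at most one common line and every line contains at least two points. A projective plane of order $q\ge 2$ is a partial plane in which every point is on exactly $q+1$ lines, every line contains exactly $q+1$ points, and there are four points no three of which are collinear (it then has $q^2+q+1$ points and $q^2+q+1$ lines). An affine plane of order $q$ is the partial plane obtained from a projective plane of order $q$ by removing one line and removing the points of that line from all other lines; it has $q^2$ points and $q+1$ lines through each point. The plane is arbitrary (not assumed to be coordinatized by a field). For a graph $G$ (finite, simple, undirected) and a partial plane $\pi$ with point set $\mathcal{P}$ and line set $\mathcal{L}$, an embedding of $G$ in $\pi$ is an injective map $f: V(G)\cup E(G)\to \mathcal{P}\cup\mathcal{L}$ with $f(V(G))\subset \mathcal{P}$, $f(E(G))\subset\mathcal{L}$, such that whenever a vertex $x$ is incident with an edge $e$ in $G$, the point $f(x)$ is incident with the line $f(e)$ in $\pi$. We write $G\hookrightarrow \pi$ if such an embedding exists. $C_k$ denotes the cycle graph on $k$ vertices. (So $C_k\hookrightarrow\pi$ means there are $k$ distinct points $P_1,\dots,P_k$ such that the lines $P_1P_2, P_2P_3,\dots,P_{k-1}P_k,P_kP_1$ exist and are $k$ distinct lines.) *)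

theory Defs
  imports Main
begin

section \<open>Incidence structures and planes\<close>

record ('p, 'l) incidence_structure =
  points :: "'p set"
  lines :: "'l set"
  incident :: "'p \<Rightarrow> 'l \<Rightarrow> bool"

definition points_on :: "('p, 'l) incidence_structure \<Rightarrow> 'l \<Rightarrow> 'p set" where
  "points_on S m = {p \<in> points S. incident S p m}"

definition lines_through :: "('p, 'l) incidence_structure \<Rightarrow> 'p \<Rightarrow> 'l set" where
  "lines_through S p = {m \<in> lines S. incident S p m}"

definition collinear :: "('p, 'l) incidence_structure \<Rightarrow> 'p set \<Rightarrow> bool" where
  "collinear S T \<longleftrightarrow> (\<exists>m\<in>lines S. T \<subseteq> points_on S m)"

definition partial_plane :: "('p, 'l) incidence_structure \<Rightarrow> bool" where
  "partial_plane S \<longleftrightarrow>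
     (\<forall>p\<in>points S. \<forall>r\<in>points S. p \<noteq> r \<longrightarrow>
        (\<forall>m\<in>lines S. \<forall>n\<in>lines S.
           {p, r} \<subseteq> points_on S m \<longrightarrow> {p, r} \<subseteq> points_on S n \<longrightarrow> m = n)) \<and>
     (\<forall>m\<in>lines S. \<exists>p\<in>points_on S m. \<exists>r\<in>points_on S m. p \<noteq> r)"

lemma partial_plane_unique:
  assumes "partial_plane S" "p \<in> points S" "r \<in> points S" "p \<noteq> r"
    and "m \<in> lines S" "n \<in> lines S"
    and "incident S p m" "incident S r m" "incident S p n" "incident S r n"
  shows "m = n"
  using assms by (simp add: partial_plane_def points_on_def)

text \<open>
  The numbers of points and lines belong to the definition: without them, the remaining
  conditions also hold for structures that are not projective planes, such as the generalized
  quadrangles of order \<open>(q, q)\<close> or disjoint unions of projective planes. With them, any two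
  points are joined by a line and any two lines meet (lemmas below).
\<close>

definition projective_plane :: "nat \<Rightarrow> ('p, 'l) incidence_structure \<Rightarrow> bool" where
  "projective_plane q S \<longleftrightarrow>
     partial_plane S \<and>
     (\<forall>p\<in>points S. card (lines_through S p) = q + 1) \<and>
     (\<forall>m\<in>lines S. card (points_on S m) = q + 1) \<and>
     (\<exists>T\<subseteq>points S. card T = 4 \<and> (\<forall>U\<subseteq>T. card U = 3 \<longrightarrow> \<not> collinear S U)) \<and>
     card (points S) = q^2 + q + 1 \<and>
     card (lines S) = q^2 + q + 1"

lemma projective_plane_join:
  assumes "projective_plane q S" "p \<in> points S" "r \<in> points S" "p \<noteq> r"
  shows "\<exists>!m. m \<in> lines S \<and> incident S p m \<and> incident S r m"
proof -
  let ?L = "lines_through S p"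
  let ?A = "\<lambda>m. points_on S m - {p}"
  have pp: "partial_plane S" using assms by (simp add: projective_plane_def)
  have uniq: "m = n" if "s \<in> points S" "s \<noteq> p" "m \<in> lines S" "n \<in> lines S"
      "incident S p m" "incident S s m" "incident S p n" "incident S s n" for s m n
    using partial_plane_unique[OF pp assms(2) that(1) _ that(3,4,5,6,7,8)] that(2) by simp
  have cL: "card ?L = q + 1" using assms by (simp add: projective_plane_def)
  have cp: "card (points S) = q^2 + q + 1" using assms by (simp add: projective_plane_def)
  have finL: "finite ?L" using cL by (intro card_ge_0_finite) simp
  have finP: "finite (points S)" using cp by (intro card_ge_0_finite) simp
  have cA: "card (?A m) = q" if "m \<in> ?L" for m
  proof -
    have "card (points_on S m) = q + 1"
      using assms(1) that by (simp add: projective_plane_def lines_through_def)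
    moreover have "p \<in> points_on S m"
      using that assms(2) by (simp add: lines_through_def points_on_def)
    ultimately show ?thesis by (simp add: card_Diff_singleton)
  qed
  have finA: "\<forall>m\<in>?L. finite (?A m)"
    using finP by (simp add: points_on_def)
  have disj: "\<forall>m\<in>?L. \<forall>n\<in>?L. m \<noteq> n \<longrightarrow> ?A m \<inter> ?A n = {}"
    using uniq by (simp add: points_on_def lines_through_def) blast
  have "card (\<Union>m\<in>?L. ?A m) = (\<Sum>m\<in>?L. card (?A m))"
    by (rule card_UN_disjoint[OF finL finA disj])
  also have "\<dots> = (q + 1) * q" using cA cL by simp
  also have "\<dots> = card (points S - {p})"
    using cp assms(2) by (simp add: card_Diff_singleton power2_eq_square)
  finally have "(\<Union>m\<in>?L. ?A m) = points S - {p}"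
    using finP by (intro card_subset_eq) (auto simp: points_on_def)
  then have "r \<in> (\<Union>m\<in>?L. ?A m)" using assms(3,4) by simp
  then obtain m where "m \<in> lines S" "incident S p m" "incident S r m"
    by (auto simp: points_on_def lines_through_def)
  then show ?thesis using partial_plane_unique[OF pp assms(2,3,4)] by blast
qed

lemma projective_plane_meet:
  assumes "projective_plane q S" "m \<in> lines S" "n \<in> lines S" "m \<noteq> n"
  shows "\<exists>!p. p \<in> points S \<and> incident S p m \<and> incident S p n"
proof -
  let ?P = "points_on S m"
  let ?A = "\<lambda>p. lines_through S p - {m}"
  have pp: "partial_plane S" using assms by (simp add: projective_plane_def)
  have uniq: "p = r" if "s \<in> lines S" "s \<noteq> m" "p \<in> points S" "r \<in> points S"
      "incident S p m" "incident S p s" "incident S r m" "incident S r s" for s p r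
    using partial_plane_unique[OF pp that(3,4) _ assms(2) that(1,5,7,6,8)] that(2) by metis
  have cP: "card ?P = q + 1" using assms by (simp add: projective_plane_def)
  have cl: "card (lines S) = q^2 + q + 1" using assms by (simp add: projective_plane_def)
  have finP: "finite ?P" using cP by (intro card_ge_0_finite) simp
  have finL: "finite (lines S)" using cl by (intro card_ge_0_finite) simp
  have cA: "card (?A p) = q" if "p \<in> ?P" for p
  proof -
    have "card (lines_through S p) = q + 1"
      using assms(1) that by (simp add: projective_plane_def points_on_def)
    moreover have "m \<in> lines_through S p"
      using that assms(2) by (simp add: lines_through_def points_on_def)
    ultimately show ?thesis by (simp add: card_Diff_singleton)
  qed
  have finA: "\<forall>p\<in>?P. finite (?A p)"
    using finL by (simp add: lines_through_def)
  have disj: "\<forall>p\<in>?P. \<forall>r\<in>?P. p \<noteq> r \<longrightarrow> ?A p \<inter> ?A r = {}"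
    using uniq by (simp add: points_on_def lines_through_def) blast
  have "card (\<Union>p\<in>?P. ?A p) = (\<Sum>p\<in>?P. card (?A p))"
    by (rule card_UN_disjoint[OF finP finA disj])
  also have "\<dots> = (q + 1) * q" using cA cP by simp
  also have "\<dots> = card (lines S - {m})"
    using cl assms(2) by (simp add: card_Diff_singleton power2_eq_square)
  finally have "(\<Union>p\<in>?P. ?A p) = lines S - {m}"
    using finL by (intro card_subset_eq) (auto simp: lines_through_def)
  then have "n \<in> (\<Union>p\<in>?P. ?A p)" using assms(3,4) by simp
  then obtain p where "p \<in> points S" "incident S p m" "incident S p n"
    by (auto simp: points_on_def lines_through_def)
  then show ?thesis using uniq[OF assms(3) assms(4)[symmetric]] by blast
qed

text \<open>
  Since incidence is only ever used between members of \<open>points\<close> and \<open>lines\<close>, shrinking the set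
  of points also removes these points from the remaining lines.
\<close>

definition remove_line :: "('p, 'l) incidence_structure \<Rightarrow> 'l \<Rightarrow> ('p, 'l) incidence_structure" where
  "remove_line S m =
     \<lparr>points = points S - points_on S m, lines = lines S - {m}, incident = incident S\<rparr>"

definition affine_plane :: "nat \<Rightarrow> ('p, 'l) incidence_structure \<Rightarrow> bool" where
  "affine_plane q A \<longleftrightarrow> (\<exists>S. \<exists>m\<in>lines S. projective_plane q S \<and> A = remove_line S m)"

section \<open>Graphs and embeddings\<close>

record 'v graph =
  verts :: "'v set"
  edges :: "'v set set"

definition simple_graph :: "'v graph \<Rightarrow> bool" where
  "simple_graph G \<longleftrightarrow> finite (verts G) \<and> (\<forall>e\<in>edges G. e \<subseteq> verts G \<and> card e = 2)"

text \<open>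
  An injective map from the disjoint union of vertices and edges to the disjoint union of points
  and lines that sends vertices to points and edges to lines is the same as a pair of injective
  maps.
\<close>

definition embedding ::
  "'v graph \<Rightarrow> ('p, 'l) incidence_structure \<Rightarrow> ('v \<Rightarrow> 'p) \<Rightarrow> ('v set \<Rightarrow> 'l) \<Rightarrow> bool" where
  "embedding G S f g \<longleftrightarrow>
     f ` verts G \<subseteq> points S \<and> g ` edges G \<subseteq> lines S \<and>
     inj_on f (verts G) \<and> inj_on g (edges G) \<and>
     (\<forall>x\<in>verts G. \<forall>e\<in>edges G. x \<in> e \<longrightarrow> incident S (f x) (g e))"

definition embeds :: "'v graph \<Rightarrow> ('p, 'l) incidence_structure \<Rightarrow> bool"
    (infix "\<hookrightarrow>" 50) where
  "G \<hookrightarrow> S \<longleftrightarrow> (\<exists>f g. embedding G S f g)"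

definition cycle_graph :: "nat \<Rightarrow> nat graph" where
  "cycle_graph k = \<lparr>verts = {..<k}, edges = {{i, (i + 1) mod k} | i. i < k}\<rparr>"

lemma simple_graph_cycle_graph:
  assumes "3 \<le> k"
  shows "simple_graph (cycle_graph k)"
proof -
  have "i \<noteq> (i + 1) mod k" if "i < k" for i
    using that assms by (cases "i + 1 = k") auto
  then show ?thesis
    using assms by (fastforce simp: simple_graph_def cycle_graph_def)
qed

end

theory Submission
  imports Defs "HOL-Combinatorics.Cycles" "HOL-Combinatorics.Orbits"
begin

text \<open>
  Fix a point \<open>O\<close> of the affine plane, number the \<open>q + 1\<close> lines through it (the rays) by the
  residues modulo \<open>q + 1\<close>, and colour every other point by its ray. Move a point \<open>x\<close> of colour
  \<open>i\<close> parallel to ray \<open>i - 2\<close> until it hits ray \<open>i - 1\<close>. This is a permutation \<open>rot\<close> of the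
  points other than \<open>O\<close>, and the line \<open>link x\<close> joining \<open>x\<close> to \<open>rot x\<close> determines \<open>x\<close>: its
  direction gives the colour, and then \<open>x\<close> is its intersection with the ray of that colour
  (\<open>affine_plane_rotation\<close>). So the cycles of \<open>rot\<close> are cycles of the plane with pairwise different
  lines, and together they cover all \<open>q\<^sup>2 - 1\<close> points; the \<open>q + 1\<close> rays and the point \<open>O\<close> remain
  available to connect pieces of them.

  One step of \<open>rot\<close> lowers the colour by one, so every cycle of \<open>rot\<close> has a length divisible by
  \<open>q + 1\<close> and there are at most \<open>q - 1\<close> cycles. Cutting a cycle of \<open>rot\<close> open at a point of
  colour \<open>c\<close> gives a path through all its points from colour \<open>c\<close> to colour \<open>c + 1\<close>; omitting
  some points at the end of the path raises the final colour further. Where one path ends and the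
  next begins with the same colour, the common ray connects them (\<open>prepend_cycles\<close>). Finally, a
  path whose end points lie on two different unused rays is closed by these rays and \<open>O\<close>
  (\<open>cycle_embeds_if_closed_through_centre\<close>).

  To reach a given length \<open>k\<close>, use as many cycles of \<open>rot\<close> as have together fewer than \<open>k - 1\<close>
  points, and supply the missing points by a piece of one further cycle, possibly all of it. Running
  through everything along \<open>rot\<close> succeeds unless the ray of the last point is the one that the path
  starts on or has connected two earlier pieces. There are three ways out, depending on the final colour: omit one
  point of a suitable earlier cycle, so that just the critical ray is skipped, and add one point at
  the end; run through the last piece against \<open>rot\<close>; or, if there is no earlier cycle,
  take a shortcut inside the single cycle (\<open>cycle_embeds_along_cycles\<close>).
\<close>

section \<open>Paths in incidence structures\<close>

definition path :: "('p, 'l) incidence_structure \<Rightarrow> 'p list \<Rightarrow> 'l list \<Rightarrow> bool" where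
  "path S xs ls \<longleftrightarrow>
     length xs = Suc (length ls) \<and> distinct xs \<and> distinct ls \<and>
     set xs \<subseteq> points S \<and> set ls \<subseteq> lines S \<and>
     (\<forall>i<length ls. incident S (xs ! i) (ls ! i) \<and> incident S (xs ! Suc i) (ls ! i))"

lemma path_singleton: "p \<in> points S \<Longrightarrow> path S [p] []"
  by (simp add: path_def)

lemma path_nonempty: "path S xs ls \<Longrightarrow> xs \<noteq> []"
  by (auto simp: path_def)

lemma path_append:
  assumes xs: "path S xs ls" and ys: "path S ys ms"
    and disj: "set xs \<inter> set ys = {}" "set ls \<inter> set ms = {}"
    and l: "l \<in> lines S" "l \<notin> set ls" "l \<notin> set ms"
    and inc: "incident S (last xs) l" "incident S (hd ys) l"
  shows "path S (xs @ ys) (ls @ l # ms)"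
proof -
  have len: "length xs = Suc (length ls)" "length ys = Suc (length ms)"
    using xs ys by (auto simp: path_def)
  have last: "last xs = xs ! length ls" and hd: "hd ys = ys ! 0"
    using path_nonempty[OF xs] path_nonempty[OF ys] len by (auto simp: last_conv_nth hd_conv_nth)
  have "incident S ((xs @ ys) ! i) ((ls @ l # ms) ! i)
      \<and> incident S ((xs @ ys) ! Suc i) ((ls @ l # ms) ! i)"
    if i: "i < length (ls @ l # ms)" for i
  proof -
    consider "i < length ls" | "i = length ls" | j where "i = Suc (length ls) + j" "j < length ms"
    proof (cases "i \<le> length ls")
      case False
      then obtain j where "i = Suc (length ls) + j" by (metis not_less_eq_eq le_Suc_ex)
      with i show ?thesis by (auto intro: that)
    qed (use that in force)
    then show ?thesis
    proof cases
      case 1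
      then show ?thesis using xs len by (simp add: path_def nth_append)
    next
      case 2
      then show ?thesis using inc last hd len by (simp add: nth_append)
    next
      case 3
      then show ?thesis using ys len by (simp add: path_def nth_append)
    qed
  qed
  then show ?thesis using xs ys disj l unfolding path_def by auto
qed

lemma path_rev:
  assumes "path S xs ls"
  shows "path S (rev xs) (rev ls)"
proof -
  have len: "length xs = Suc (length ls)" using assms by (simp add: path_def)
  have "incident S (rev xs ! i) (rev ls ! i) \<and> incident S (rev xs ! Suc i) (rev ls ! i)"
    if i: "i < length ls" for i
  proof -
    define j where "j = length ls - Suc i"
    have j: "j < length ls" and "rev ls ! i = ls ! j" "rev xs ! i = xs ! Suc j" "rev xs ! Suc i = xs ! j"
      using i len by (auto simp: j_def rev_nth Suc_diff_Suc)
    then show ?thesis using assms by (simp add: path_def)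
  qed
  then show ?thesis using assms by (simp add: path_def)
qed

lemma path_take:
  assumes "path S xs ls" "a \<le> length ls"
  shows "path S (take (Suc a) xs) (take a ls)"
  using assms by (auto simp: path_def dest: in_set_takeD)

lemma path_drop:
  assumes "path S xs ls" "a \<le> length ls"
  shows "path S (drop a xs) (drop a ls)"
  using assms by (auto simp: path_def dest: in_set_dropD)

lemma path_shortcut:
  assumes path: "path S xs ls" and ab: "a < b" "b \<le> length ls"
    and l: "l \<in> lines S" "l \<notin> set ls" "incident S (xs ! a) l" "incident S (xs ! b) l"
  shows "path S (take (Suc a) xs @ drop b xs) (take a ls @ l # drop b ls)"
proof (rule path_append)
  have len: "length xs = Suc (length ls)" and dist: "distinct xs" "distinct ls"
    using path by (auto simp: path_def)
  show "path S (take (Suc a) xs) (take a ls)" "path S (drop b xs) (drop b ls)"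
    using path ab by (auto intro: path_take path_drop)
  show "set (take (Suc a) xs) \<inter> set (drop b xs) = {}" "set (take a ls) \<inter> set (drop b ls) = {}"
    using ab dist by (auto intro!: set_take_disj_set_drop_if_distinct)
  show "l \<notin> set (take a ls)" "l \<notin> set (drop b ls)"
    using l(2) by (auto dest: in_set_takeD in_set_dropD)
  show "incident S (last (take (Suc a) xs)) l"
    using l(3) ab len by (simp add: take_Suc_conv_app_nth)
  show "incident S (hd (drop b xs)) l"
    using l(4) ab len by (simp add: hd_drop_conv_nth)
qed (use l in auto)

text \<open>
  For \<open>k = 2\<close> the two indices describe the same pair; this is where cycles need three vertices.
\<close>

lemma inj_on_cycle_edge:
  fixes k :: nat
  assumes "3 \<le> k"
  shows "inj_on (\<lambda>i. {i, (i + 1) mod k}) {..<k}"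
proof (rule inj_onI)
  fix i j assume ij: "i \<in> {..<k}" "j \<in> {..<k}" "{i, (i + 1) mod k} = {j, (j + 1) mod k}"
  have suc: "(a + 1) mod k = (if a + 1 = k then 0 else a + 1)" if "a < k" for a :: nat
    using that by auto
  show "i = j"
    using ij assms by (auto simp: doubleton_eq_iff suc simp del: One_nat_def split: if_splits)
qed

text \<open>
  Numbering the points along the path turns it into an embedding: the edge from \<open>i\<close> to \<open>i + 1\<close>
  goes to the \<open>i\<close>-th line of the path, and the edge from the last vertex back to \<open>0\<close> to \<open>l\<close>.
\<close>

lemma cycle_embeds_if_closed_path:
  assumes path: "path S xs ls" and len: "3 \<le> length xs"
    and l: "l \<in> lines S" "l \<notin> set ls" "incident S (hd xs) l" "incident S (last xs) l"
  shows "cycle_graph (length xs) \<hookrightarrow> S"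
proof -
  define k where "k = length xs"
  define ms where "ms = ls @ [l]"
  let ?edge = "\<lambda>i. {i, (i + 1) mod k}"
  define g where "g e = ms ! the_inv_into {..<k} ?edge e" for e
  have inj: "inj_on ?edge {..<k}" using len inj_on_cycle_edge by (simp add: k_def)
  have lens: "length ls = k - 1" "length ms = k" "0 < k" "xs \<noteq> []"
    using path by (auto simp: path_def k_def ms_def)
  have g: "g (?edge i) = ms ! i" if "i < k" for i
    using the_inv_into_f_f[OF inj, of i] that by (simp add: g_def)
  have dist: "distinct xs" "distinct ms" and sub: "set xs \<subseteq> points S" "set ms \<subseteq> lines S"
    using path l by (auto simp: path_def ms_def)
  have inc: "incident S (xs ! i) (ms ! i) \<and> incident S (xs ! ((i + 1) mod k)) (ms ! i)"
    if "i < k" for i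
  proof (cases "i < k - 1")
    case True
    then have "(i + 1) mod k = Suc i" by simp
    then show ?thesis using path True lens by (simp add: path_def ms_def nth_append)
  next
    case False
    with that have i: "i = k - 1" by simp
    moreover have "(i + 1) mod k = 0" "ms ! i = l"
      using i lens by (auto simp: ms_def nth_append)
    moreover have "xs ! i = last xs" "xs ! 0 = hd xs"
      using i lens(4) by (auto simp: last_conv_nth hd_conv_nth k_def)
    ultimately show ?thesis using l by simp
  qed
  have verts: "verts (cycle_graph k) = {..<k}" and edges: "edges (cycle_graph k) = ?edge ` {..<k}"
    by (auto simp: cycle_graph_def)
  have "embedding (cycle_graph k) S (nth xs) g"
    unfolding embedding_def verts edges
  proof (intro conjI ballI impI)
    show "(!) xs ` {..<k} \<subseteq> points S" using sub(1) by (auto simp: k_def)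
    show "g ` ?edge ` {..<k} \<subseteq> lines S"
      using sub(2) g lens(2) by (auto simp del: One_nat_def)
    show "inj_on ((!) xs) {..<k}" using dist(1) by (simp add: k_def inj_on_nth)
    show "inj_on g (?edge ` {..<k})"
    proof (rule inj_onI, clarify)
      fix i j assume "i < k" "j < k" "g (?edge i) = g (?edge j)"
      then have "i = j" using g lens(2) dist(2) by (simp add: nth_eq_iff_index_eq)
      then show "?edge i = ?edge j" by simp
    qed
    fix v e assume "v \<in> {..<k}" "e \<in> ?edge ` {..<k}" "v \<in> e"
    then obtain i where i: "i < k" "e = ?edge i" "v = i \<or> v = (i + 1) mod k" by blast
    then show "incident S (xs ! v) (g e)"
      using inc[OF i(1)] g[OF i(1)] by metis
  qed
  then show ?thesis by (auto simp: embeds_def k_def)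
qed


section \<open>Arithmetic of colours\<close>

lemma residue_eq_if_shift_eq:
  fixes c c' i q :: nat
  assumes "c \<le> q" "c' \<le> q" "(c + i) mod (q + 1) = (c' + i) mod (q + 1)"
  shows "c = c'"
proof -
  have "(int c + int i) mod int (q + 1) = (int c' + int i) mod int (q + 1)"
    using arg_cong[OF assms(3), of int] by (simp only: zmod_int of_nat_add)
  then have "int c mod int (q + 1) = int c' mod int (q + 1)"
    by (metis add_diff_cancel_right' mod_diff_left_eq)
  then show ?thesis using assms(1,2) by simp
qed

lemma less_if_less_Suc:
  fixes d :: "nat \<Rightarrow> nat"
  assumes "\<And>i. i < t \<Longrightarrow> d i < d (Suc i)" and "i < j" "j \<le> t"
  shows "d i < d j"
  using assms(2,3)
proof (induction j)
  case (Suc j)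
  then show ?case using assms(1)[of j] by (cases "i = j") auto
qed simp


section \<open>Rotations about a point\<close>

text \<open>
  This collects all that the construction of cycles uses of the geometry. Colours are kept in
  \<open>{0..q}\<close>, so lowering a colour by one modulo \<open>q + 1\<close> is adding \<open>q\<close>. Each line \<open>link x\<close> belongs
  to one point \<open>x\<close> only and is not a ray; therefore pieces of different cycles of \<open>rot\<close> and
  rays never share a line.
\<close>

locale rotation =
  fixes S :: "('p, 'l) incidence_structure" and q :: nat and centre :: 'p
    and ray :: "nat \<Rightarrow> 'l" and col :: "'p \<Rightarrow> nat" and rot :: "'p \<Rightarrow> 'p" and link :: "'p \<Rightarrow> 'l"
    and R :: "'p set"
  defines "R \<equiv> points S - {centre}"
  assumes q_ge_2: "2 \<le> q"
    and centre: "centre \<in> points S"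
    and card_points: "card (points S) = q^2"
    and ray: "i \<le> q \<Longrightarrow> ray i \<in> lines S" "i \<le> q \<Longrightarrow> incident S centre (ray i)"
    and inj_ray: "inj_on ray {..q}"
    and col: "x \<in> R \<Longrightarrow> col x \<le> q" "x \<in> R \<Longrightarrow> incident S x (ray (col x))"
    and rot: "rot permutes R"
    and col_rot: "x \<in> R \<Longrightarrow> col (rot x) = (col x + q) mod (q + 1)"
    and link: "x \<in> R \<Longrightarrow> link x \<in> lines S"
      "x \<in> R \<Longrightarrow> incident S x (link x)" "x \<in> R \<Longrightarrow> incident S (rot x) (link x)"
    and inj_link: "inj_on link R"
    and link_not_ray: "x \<in> R \<Longrightarrow> i \<le> q \<Longrightarrow> link x \<noteq> ray i"
begin

lemma finite_R: "finite R"
  using card_points q_ge_2 card.infinite by (fastforce simp: R_def)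

lemma card_R: "card R + 1 = q^2"
proof -
  have "0 < q^2" using q_ge_2 by simp
  then show ?thesis
    using centre card_points by (simp add: R_def card_Diff_singleton)
qed

lemma permutation_rot: "permutation rot"
  using rot finite_R by (auto simp: permutation_permutes)

lemma rot_iter_in_R: "x \<in> R \<Longrightarrow> (rot ^^ i) x \<in> R"
  using permutes_funpow[OF rot] by (simp add: permutes_in_image)

text \<open>
  Adding the number of steps back to the colour avoids subtraction on residues.
\<close>

lemma col_rot_iter:
  assumes "x \<in> R"
  shows "(col ((rot ^^ i) x) + i) mod (q + 1) = col x"
proof (induction i)
  case 0
  show ?case using col(1)[OF assms] by simp
next
  case (Suc i)
  let ?y = "(rot ^^ i) x"
  have "(col (rot ?y) + Suc i) mod (q + 1) = ((col ?y + q) mod (q + 1) + Suc i) mod (q + 1)"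
    using col_rot rot_iter_in_R[OF assms] by simp
  also have "\<dots> = (col ?y + q + Suc i) mod (q + 1)" by (rule mod_add_left_eq)
  also have "\<dots> = ((col ?y + i) + (q + 1)) mod (q + 1)" by (simp add: algebra_simps)
  also have "\<dots> = (col ?y + i) mod (q + 1)" by (rule mod_add_self2)
  finally show ?case using Suc by simp
qed

lemma col_rot_iter_eq:
  assumes x: "x \<in> R" and c: "c \<le> q" "(c + i) mod (q + 1) = col x"
  shows "col ((rot ^^ i) x) = c"
proof -
  have "(col ((rot ^^ i) x) + i) mod (q + 1) = (c + i) mod (q + 1)"
    using col_rot_iter[OF x, of i] c(2) by (rule trans[OF _ sym])
  then show ?thesis
    using residue_eq_if_shift_eq[OF col(1)[OF rot_iter_in_R[OF x]] c(1)] by blast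
qed

context
  fixes B assumes B: "cyclic_on rot B" "B \<subseteq> R"
begin

lemma rot_iter_in_cycle: "x \<in> B \<Longrightarrow> (rot ^^ i) x \<in> B"
  using B by (simp add: cyclic_on_funpow_in)

lemma finite_cycle: "finite B"
  using B finite_R finite_subset by blast

lemma least_power_eq_card_cycle:
  assumes "x \<in> B"
  shows "least_power rot x = card B"
proof -
  have "set (support rot x) = range (\<lambda>i. (rot ^^ i) x)"
    by (rule support_set[OF permutation_rot])
  also have "\<dots> = B"
    using orbit_cyclic_eq3[OF B(1) assms] orbit_altdef_permutation[OF permutation_rot, of x] by auto
  finally have "card B = length (support rot x)"
    using cycle_of_permutation[OF permutation_rot, of x] by (metis distinct_card)
  then show ?thesis by simp
qed

lemma rot_card_cycle: "x \<in> B \<Longrightarrow> (rot ^^ card B) x = x"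
  using least_power_of_permutation(1)[OF permutation_rot, of x] least_power_eq_card_cycle by simp

lemma distinct_rot_iter:
  assumes "x \<in> B" "n \<le> card B"
  shows "distinct (map (\<lambda>i. (rot ^^ i) x) [0..<n])"
proof -
  have "distinct (map (\<lambda>i. (rot ^^ i) x) [0..<card B])"
    using cycle_of_permutation[OF permutation_rot, of x] least_power_eq_card_cycle[OF assms(1)]
    by simp
  from distinct_take[OF this, of n] show ?thesis
    using assms(2) by (simp add: take_map)
qed

lemma dvd_card_cycle: "(q + 1) dvd card B"
proof -
  obtain x where x: "x \<in> B" using B(1) by (auto simp: cyclic_on_def)
  have xR: "x \<in> R" using x B by blast
  have "(col x + card B) mod (q + 1) = col x"
    using col_rot_iter[OF xR, of "card B"] rot_card_cycle[OF x] by simp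
  also have "\<dots> = (col x) mod (q + 1)" using col(1)[OF xR] by simp
  finally have "(q + 1) dvd (col x + card B - col x)"
    by (subst (asm) mod_eq_dvd_iff_nat) auto
  then show ?thesis by simp
qed

lemma card_cycle_ge: "q + 1 \<le> card B"
proof (rule dvd_imp_le[OF dvd_card_cycle])
  show "0 < card B" using B(1) finite_cycle by (auto simp: card_gt_0_iff cyclic_on_def)
qed

text \<open>
  Going around lowers the colour by one at every step, so all colours occur; any cycle can therefore
  be entered from any ray.
\<close>

lemma point_of_col_in_cycle:
  assumes "c \<le> q"
  obtains x where "x \<in> B" "col x = c"
proof -
  obtain x where x: "x \<in> B" using B(1) by (auto simp: cyclic_on_def)
  have xR: "x \<in> R" using x B by blast
  have "c + (col x + (q + 1) - c) = col x + (q + 1)" using assms by simp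
  then have "(c + (col x + (q + 1) - c)) mod (q + 1) = col x"
    using col(1)[OF xR] by (metis le_imp_less_Suc mod_add_self2 mod_less Suc_eq_plus1)
  then have "col ((rot ^^ (col x + (q + 1) - c)) x) = c"
    by (rule col_rot_iter_eq[OF xR assms])
  then show thesis using that rot_iter_in_cycle[OF x] by blast
qed

text \<open>
  The piece may be as long as the whole cycle of \<open>rot\<close>: the link of its last point is left out, so
  the path does not close up.
\<close>

lemma path_along_cycle:
  assumes x: "x \<in> B" and n: "0 < n" "n \<le> card B"
  defines "xs \<equiv> map (\<lambda>i. (rot ^^ i) x) [0..<n]"
  shows "path S xs (map link (butlast xs))"
    and "set xs \<subseteq> B" "set (map link (butlast xs)) \<subseteq> link ` B"
    and "length xs = n" "hd xs = x" "last xs = (rot ^^ (n - 1)) x"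
proof -
  show sub: "set xs \<subseteq> B" using rot_iter_in_cycle[OF x] by (auto simp: xs_def)
  show "set (map link (butlast xs)) \<subseteq> link ` B"
    using sub by (auto dest: in_set_butlastD)
  show len: "length xs = n" by (simp add: xs_def)
  show "hd xs = x" "last xs = (rot ^^ (n - 1)) x"
    using n by (auto simp: xs_def hd_map last_map)
  have dist: "distinct xs" unfolding xs_def by (rule distinct_rot_iter[OF x n(2)])
  have subR: "set (butlast xs) \<subseteq> R" using sub B by (auto dest: in_set_butlastD)
  have "distinct (map link (butlast xs))"
    using dist inj_on_subset[OF inj_link subR] by (simp add: distinct_map distinct_butlast)
  moreover have "incident S (xs ! i) (link (xs ! i))" "incident S (xs ! Suc i) (link (xs ! i))"
    if "i < n - 1" for i
    using that link(2,3)[OF rot_iter_in_R] x B by (auto simp: xs_def)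
  moreover have "set xs \<subseteq> points S" using sub B(2) by (auto simp: R_def)
  moreover have "set (map link (butlast xs)) \<subseteq> lines S" using subR link(1) by auto
  ultimately show "path S xs (map link (butlast xs))"
    using len n dist unfolding path_def by (auto simp: nth_butlast)
qed

end

text \<open>
  \<open>D\<close> contains the colours of the rays that the path has used. The two rays through its end points
  meet in the centre, which the path avoids.
\<close>

lemma cycle_embeds_if_closed_through_centre:
  assumes path: "path S xs ls" and xs: "set xs \<subseteq> R"
    and ls: "set ls \<subseteq> link ` R \<union> ray ` D" and D: "D \<subseteq> {..q}"
    and ends: "col (hd xs) \<notin> D" "col (last xs) \<notin> D" "col (hd xs) \<noteq> col (last xs)"
  shows "cycle_graph (Suc (length xs)) \<hookrightarrow> S"
proof -
  have ne: "xs \<noteq> []" by (rule path_nonempty[OF path])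
  have R: "hd xs \<in> R" "last xs \<in> R" using ne xs by auto
  have fresh: "ray c \<notin> set ls" if "c \<le> q" "c \<notin> D" for c
  proof
    assume "ray c \<in> set ls"
    with ls link_not_ray[OF _ that(1)] obtain d where "d \<in> D" "ray c = ray d" by force
    then show False using inj_onD[OF inj_ray, of c d] D that by auto
  qed
  have "path S (xs @ [centre]) (ls @ ray (col (last xs)) # [])"
    using path xs R ends(2) fresh col ray centre
    by (intro path_append path_singleton) (auto simp: R_def)
  then have "cycle_graph (length (xs @ [centre])) \<hookrightarrow> S"
  proof (rule cycle_embeds_if_closed_path)
    have "length xs \<noteq> 1"
      using ends(3) by (auto simp: length_Suc_conv)
    moreover have "length xs \<noteq> 0" using ne by simp
    ultimately have "2 \<le> length xs" by linarith
    then show "3 \<le> length (xs @ [centre])" by simp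
    show "ray (col (hd xs)) \<in> lines S" "incident S (last (xs @ [centre])) (ray (col (hd xs)))"
      "incident S (hd (xs @ [centre])) (ray (col (hd xs)))"
      using ray col R ne by auto
    show "ray (col (hd xs)) \<notin> set (ls @ [ray (col (last xs))])"
      using fresh[OF col(1)[OF R(1)] ends(1)] ends(3) R col(1) inj_onD[OF inj_ray] by auto
  qed
  then show ?thesis by simp
qed

text \<open>
  The path is built from its end: to a final piece \<open>ys\<close>, the cycles \<open>W (t - 1)\<close>, ..., \<open>W 0\<close> are
  prepended in turn. The piece in \<open>W i\<close> starts with colour \<open>d i\<close>, ends with colour \<open>d (Suc i)\<close>, and
  is connected to its successor by the ray of that colour. A complete cycle raises the colour
  by one, so the piece omits \<open>d (Suc i) - d i - 1\<close> points, which sums up to the stated length. As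
  \<open>d\<close> increases strictly, no ray is used twice.
\<close>

lemma prepend_cycles:
  fixes W :: "nat \<Rightarrow> 'p set" and d :: "nat \<Rightarrow> nat"
  assumes "\<And>i. i < t \<Longrightarrow> cyclic_on rot (W i) \<and> W i \<subseteq> R"
    and "\<And>i j. i < t \<Longrightarrow> j < t \<Longrightarrow> i \<noteq> j \<Longrightarrow> W i \<inter> W j = {}"
    and "\<And>i. i < t \<Longrightarrow> d i < d (Suc i)" and "d t \<le> q"
    and "path S ys ms" "set ys \<subseteq> R - (\<Union>i<t. W i)" "col (hd ys) = d t"
    and "set ms \<inter> link ` (\<Union>i<t. W i) = {}" "set ms \<inter> ray ` d ` {1..t} = {}"
  shows "\<exists>xs ls. path S xs ls \<and> set xs \<subseteq> R \<and> col (hd xs) = d 0 \<and> last xs = last ys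
    \<and> length xs + d t = (\<Sum>i<t. card (W i)) + length ys + t + d 0
    \<and> set ls \<subseteq> set ms \<union> link ` (\<Union>i<t. W i) \<union> ray ` d ` {1..t}"
  using assms
proof (induction t arbitrary: ys ms)
  case 0
  then show ?case by (intro exI[of _ ys] exI[of _ ms]) auto
next
  case (Suc t)
  let ?U = "\<Union>i<t. W i"
  note disjoint = Suc.prems(2) and incr = Suc.prems(3)
  have Wt: "cyclic_on rot (W t)" "W t \<subseteq> R" using Suc.prems(1) by auto
  have mono: "d i < d j" if "i < j" "j \<le> Suc t" for i j
    using less_if_less_Suc[of "Suc t" d, OF incr that] .
  have dq: "d i \<le> q" if "i \<le> Suc t" for i
    using mono[of i "Suc t"] Suc.prems(4) that by (cases "i = Suc t") auto
  have "W t \<inter> W i = {}" if "i < t" for i using disjoint[of t i] that by simp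
  then have disjU: "W t \<inter> ?U = {}" by auto
  have UR: "?U \<subseteq> R" using Suc.prems(1) by (auto simp: less_Suc_eq)
  obtain x where x: "x \<in> W t" "col x = d t"
    using point_of_col_in_cycle[OF Wt, of "d t"] dq by auto
  \<comment> \<open>The colour falls by \<open>n - 1\<close>, that is, by \<open>d t - d (Suc t)\<close> modulo \<open>q + 1\<close>.\<close>
  define n where "n = card (W t) + 1 + d t - d (Suc t)"
  have card: "q + 1 \<le> card (W t)" by (rule card_cycle_ge[OF Wt])
  obtain v where v: "card (W t) = (q + 1) * v" using dvd_card_cycle[OF Wt] by (rule dvdE)
  have n: "0 < n" "n \<le> card (W t)" "n + d (Suc t) = card (W t) + 1 + d t"
    using card mono[of t "Suc t"] dq[of "Suc t"] by (auto simp: n_def)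
  let ?zs = "map (\<lambda>i. (rot ^^ i) x) [0..<n]"
  note arc = path_along_cycle[OF Wt x(1) n(1,2)]
  have zsR: "last ?zs \<in> R" using arc(6) Wt(2) x(1) rot_iter_in_R by auto
  have col_last: "col (last ?zs) = d (Suc t)"
    unfolding arc(6)
  proof (rule col_rot_iter_eq)
    have "d (Suc t) + (n - 1) = card (W t) + d t" using n by simp
    also have "\<dots> mod (q + 1) = d t mod (q + 1)"
      using v by (simp only: mod_mult_self4)
    finally show "(d (Suc t) + (n - 1)) mod (q + 1) = col x" using x dq[of t] by simp
  qed (use x Wt dq in auto)
  let ?l = "ray (d (Suc t))"
  have lines: "set (map link (butlast ?zs)) \<subseteq> link ` W t" by (rule arc(3))
  have l_not_link: "?l \<notin> link ` R" using link_not_ray dq[of "Suc t"] by force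
  have ysne: "hd ys \<in> R"
    using hd_in_set[OF path_nonempty[OF Suc.prems(5)]] Suc.prems(6) by blast
  have new_path: "path S (?zs @ ys) (map link (butlast ?zs) @ ?l # ms)"
  proof (rule path_append[OF arc(1) Suc.prems(5)])
    show "set ?zs \<inter> set ys = {}" using arc(2) Suc.prems(6) by auto
    show "set (map link (butlast ?zs)) \<inter> set ms = {}" using lines Suc.prems(8) by auto
    show "?l \<in> lines S" using ray dq by auto
    show "?l \<notin> set (map link (butlast ?zs))" using lines Wt(2) l_not_link by blast
    show "?l \<notin> set ms" using Suc.prems(9) by auto
    show "incident S (last ?zs) ?l" using col(2)[OF zsR] col_last by simp
    show "incident S (hd ys) ?l" using col(2)[OF ysne] Suc.prems(7) by simp
  qed
  have fresh_ray: "?l \<notin> ray ` d ` {1..t}"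
  proof
    assume "?l \<in> ray ` d ` {1..t}"
    then obtain i where "i \<le> t" "?l = ray (d i)" by auto
    then show False
      using inj_onD[OF inj_ray, of "d (Suc t)" "d i"] mono[of i "Suc t"] dq[of i] dq[of "Suc t"] by auto
  qed
  have "\<exists>xs ls. path S xs ls \<and> set xs \<subseteq> R \<and> col (hd xs) = d 0 \<and> last xs = last (?zs @ ys)
    \<and> length xs + d t = (\<Sum>i<t. card (W i)) + length (?zs @ ys) + t + d 0
    \<and> set ls \<subseteq> set (map link (butlast ?zs) @ ?l # ms) \<union> link ` ?U \<union> ray ` d ` {1..t}"
  proof (rule Suc.IH[OF _ _ _ _ new_path])
    show "set (?zs @ ys) \<subseteq> R - ?U"
      using arc(2) Wt(2) disjU Suc.prems(6) by (auto simp: less_Suc_eq)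
    show "col (hd (?zs @ ys)) = d t" using arc(5) n(1) x(2) by (simp add: hd_append)
    have "link ` W t \<inter> link ` ?U = {}"
      using inj_on_image_Int[OF inj_link Wt(2) UR] disjU by simp
    then have "set (map link (butlast ?zs)) \<inter> link ` ?U = {}" using lines by blast
    moreover have "?l \<notin> link ` ?U" using l_not_link image_mono[OF UR, of link] by blast
    moreover have "set ms \<inter> link ` ?U = {}"
      using Suc.prems(8) image_mono[of ?U "\<Union>i<Suc t. W i" link] by fastforce
    ultimately show "set (map link (butlast ?zs) @ ?l # ms) \<inter> link ` ?U = {}"
      unfolding set_append list.set by blast
    have "link ` W t \<inter> ray ` d ` {1..t} = {}"
      using link_not_ray Wt(2) dq by fastforce
    then have "set (map link (butlast ?zs)) \<inter> ray ` d ` {1..t} = {}" using lines by blast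
    moreover have "set ms \<inter> ray ` d ` {1..t} = {}"
      using Suc.prems(9) by (auto simp: atLeastAtMostSuc_conv)
    ultimately show "set (map link (butlast ?zs) @ ?l # ms) \<inter> ray ` d ` {1..t} = {}"
      using fresh_ray unfolding set_append list.set by blast
    show "cyclic_on rot (W i) \<and> W i \<subseteq> R" "d i < d (Suc i)" if "i < t" for i
      using Suc.prems(1)[of i] incr[of i] that by simp_all
    show "W i \<inter> W j = {}" if "i < t" "j < t" "i \<noteq> j" for i j
      using disjoint[of i j] that by simp
    show "d t \<le> q" using dq[of t] by simp
  qed
  then obtain xs ls where IH: "path S xs ls" "set xs \<subseteq> R" "col (hd xs) = d 0"
      "last xs = last (?zs @ ys)"
      "length xs + d t = (\<Sum>i<t. card (W i)) + length (?zs @ ys) + t + d 0"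
      "set ls \<subseteq> set (map link (butlast ?zs) @ ?l # ms) \<union> link ` ?U \<union> ray ` d ` {1..t}"
    by blast
  show ?case
  proof (intro exI conjI)
    show "last xs = last ys" using IH(4) path_nonempty[OF Suc.prems(5)] by simp
    show "length xs + d (Suc t) = (\<Sum>i<Suc t. card (W i)) + length ys + Suc t + d 0"
      using IH(5) n(3) by simp
    have eqs: "link ` (\<Union>i<Suc t. W i) = link ` ?U \<union> link ` W t"
      "ray ` d ` {1..Suc t} = insert ?l (ray ` d ` {1..t})"
      by (auto simp: lessThan_Suc atLeastAtMostSuc_conv)
    have absorb: "X \<subseteq> M \<union> (U \<union> V) \<union> insert l Y"
      if "X \<subseteq> (Z \<union> insert l M) \<union> U \<union> Y" "Z \<subseteq> V" for X M U V Y Z :: "'l set" and l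
      using that by blast
    show "set ls \<subseteq> set ms \<union> link ` (\<Union>i<Suc t. W i) \<union> ray ` d ` {1..Suc t}"
      unfolding eqs using IH(6) lines unfolding set_append list.set(2) by (rule absorb)
  qed (rule IH)+
qed


text \<open>
  The rays used by the complete path are those of colour \<open>d 1\<close>, ..., \<open>d t\<close>, and the path starts
  with colour \<open>d 0 = 0\<close>. So the only obstacle to closing it through the centre is the colour of its
  last point.
\<close>

lemma cycle_embeds_through_cycles:
  fixes W :: "nat \<Rightarrow> 'p set" and d :: "nat \<Rightarrow> nat"
  assumes W: "\<And>i. i \<le> t \<Longrightarrow> cyclic_on rot (W i) \<and> W i \<subseteq> R"
    and disjoint: "\<And>i j. i \<le> t \<Longrightarrow> j \<le> t \<Longrightarrow> i \<noteq> j \<Longrightarrow> W i \<inter> W j = {}"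
    and d: "d 0 = 0" "\<And>i. i < t \<Longrightarrow> d i < d (Suc i)" "d t \<le> q"
    and ys: "path S ys ms" "set ys \<subseteq> W t" "set ms \<subseteq> link ` W t"
      "col (hd ys) = d t" "col (last ys) \<notin> d ` {..t}"
    and k: "k + d t = (\<Sum>i<t. card (W i)) + length ys + t + 1"
  shows "cycle_graph k \<hookrightarrow> S"
proof -
  let ?U = "\<Union>i<t. W i"
  have "W i \<subseteq> R" if "i \<le> t" for i using W that by blast
  then have UR: "?U \<subseteq> R" "W t \<subseteq> R" by (simp_all add: UN_subset_iff)
  have "W t \<inter> W i = {}" if "i < t" for i using disjoint[of t i] that by simp
  then have disjU: "W t \<inter> ?U = {}" by auto
  have mono: "d i < d j" if "i < j" "j \<le> t" for i j
    using less_if_less_Suc[of t d, OF d(2) that] .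
  have dq: "d i \<le> q" if "i \<le> t" for i
    using mono[of i t] d(3) that by (cases "i = t") auto
  have links: "link ` W t \<inter> link ` ?U = {}"
    using inj_on_image_Int[OF inj_link UR(2,1)] disjU by simp
  have rays: "link ` W t \<inter> ray ` d ` {1..t} = {}"
    using link_not_ray UR(2) dq by fastforce
  have shrink: "X \<inter> Z = {}" if "X \<subseteq> Y" "Y \<inter> Z = {}" for X Y Z :: "'l set"
    using that by blast
  have "\<exists>xs ls. path S xs ls \<and> set xs \<subseteq> R \<and> col (hd xs) = d 0 \<and> last xs = last ys
    \<and> length xs + d t = (\<Sum>i<t. card (W i)) + length ys + t + d 0
    \<and> set ls \<subseteq> set ms \<union> link ` ?U \<union> ray ` d ` {1..t}"
  proof (rule prepend_cycles)
    show "set ys \<subseteq> R - ?U" using ys(2) disjU UR(2) by blast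
    show "set ms \<inter> link ` ?U = {}" using ys(3) links by (rule shrink)
    show "set ms \<inter> ray ` d ` {1..t} = {}" using ys(3) rays by (rule shrink)
    show "cyclic_on rot (W i) \<and> W i \<subseteq> R" "d i < d (Suc i)" if "i < t" for i
      using W[of i] d(2)[of i] that by simp_all
    show "W i \<inter> W j = {}" if "i < t" "j < t" "i \<noteq> j" for i j
      using disjoint[of i j] that by simp
  qed (rule d ys)+
  then obtain xs ls where xs: "path S xs ls" "set xs \<subseteq> R" "col (hd xs) = d 0" "last xs = last ys"
      "length xs + d t = (\<Sum>i<t. card (W i)) + length ys + t + d 0"
      "set ls \<subseteq> set ms \<union> link ` ?U \<union> ray ` d ` {1..t}"
    by blast
  have "cycle_graph (Suc (length xs)) \<hookrightarrow> S"
  proof (rule cycle_embeds_if_closed_through_centre[OF xs(1,2)])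
    show "set ls \<subseteq> link ` R \<union> ray ` d ` {1..t}"
      using image_mono[OF UR(1)] subset_trans[OF ys(3) image_mono[OF UR(2)]]
      by (intro subset_trans[OF xs(6)] Un_mono Un_least order_refl)
    show "d ` {1..t} \<subseteq> {..q}" using dq by auto
    show "col (hd xs) \<notin> d ` {1..t}"
    proof
      assume "col (hd xs) \<in> d ` {1..t}"
      then obtain i where i: "1 \<le> i" "i \<le> t" "d i = d 0" using xs(3) by force
      then show False using mono[of 0 i] by simp
    qed
    have "col (last xs) \<notin> d ` {..t}" using xs(4) ys(5) by simp
    then have last: "col (last xs) \<noteq> d i" if "i \<le> t" for i using that by blast
    then show "col (last xs) \<notin> d ` {1..t}" by (meson atLeastAtMost_iff imageE)
    show "col (hd xs) \<noteq> col (last xs)" using xs(3) last[of 0] by simp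
  qed
  moreover have "k = Suc (length xs)" using k xs(5) d(1) by simp
  ultimately show ?thesis by simp
qed

text \<open>
  Here \<open>n\<close> consecutive points of a cycle of \<open>rot\<close> begin and end on the same ray, so the centre cannot
  close the path. Instead, start with colour \<open>0\<close> and replace the part strictly between the positions
  \<open>1\<close> and \<open>q + 2\<close>, which both have colour \<open>q\<close>, by the ray \<open>q\<close>. This saves \<open>q\<close> points, so the path can
  go on for \<open>q\<close> more points and ends with colour \<open>1\<close>. The longer path still fits into the
  cycle because \<open>n\<close> exceeds a multiple of \<open>q + 1\<close> by one, and the length of the cycle is such a
  multiple.
\<close>

lemma cycle_embeds_within_cycle:
  assumes B: "cyclic_on rot B" "B \<subseteq> R" and n: "1 < n" "n \<le> card B" "(q + 1) dvd (n - 1)"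
  shows "cycle_graph (n + 1) \<hookrightarrow> S"
proof -
  obtain x where x: "x \<in> B" "col x = 0" using point_of_col_in_cycle[OF B, of 0] by auto
  have xR: "x \<in> R" using x B by auto
  obtain u where u: "n = (q + 1) * u + 1" using n by (metis dvdE le_add_diff_inverse2 less_imp_le)
  obtain v where v: "card B = (q + 1) * v" using dvd_card_cycle[OF B] by (rule dvdE)
  have "(q + 1) * u < (q + 1) * v" using n(2) u v by simp
  then have "Suc u \<le> v" by (simp only: mult_less_cancel1 Suc_le_eq)
  then have "(q + 1) * Suc u \<le> (q + 1) * v" by (rule mult_le_mono2)
  then have bound: "n + q \<le> card B" using u v by simp
  have u0: "0 < u" using n(1) u by (cases u) auto
  then have nq: "q + 2 \<le> n" using u by (cases u) auto
  have "0 < n + q" using n by simp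
  define xs where "xs = map (\<lambda>i. (rot ^^ i) x) [0..<n + q]"
  define ls where "ls = map link (butlast xs)"
  note arc = path_along_cycle[OF B x(1) \<open>0 < n + q\<close> bound, folded xs_def, folded ls_def]
  have xs: "length xs = n + q" "\<And>i. i < n + q \<Longrightarrow> xs ! i = (rot ^^ i) x"
    by (auto simp: xs_def)
  have ls: "length ls = n + q - 1" using arc(1) xs(1) by (simp add: path_def)
  have xs_col: "col (xs ! i) = c" if "i < n + q" "c \<le> q" "(q + 1) dvd (c + i)" for i c
    using that x xs(2) by (auto intro: col_rot_iter_eq[OF xR])
  have subR: "set xs \<subseteq> R" "set ls \<subseteq> link ` R" using arc(2,3) B(2) by blast+
  have on_q: "incident S (xs ! i) (ray q)" if "i < n + q" "(q + 1) dvd (q + i)" for i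
  proof -
    have "xs ! i \<in> R" using that(1) subR(1) xs(1) nth_mem by auto
    then show ?thesis using col(2) xs_col[OF that(1) _ that(2)] by fastforce
  qed
  let ?ys = "take (Suc 1) xs @ drop (q + 2) xs"
  let ?ms = "take 1 ls @ ray q # drop (q + 2) ls"
  have "path S ?ys ?ms"
  proof (rule path_shortcut[OF arc(1)])
    show "1 < q + 2" "q + 2 \<le> length ls" using nq q_ge_2 ls by auto
    show "ray q \<in> lines S" using ray by simp
    show "ray q \<notin> set ls" using subR(2) link_not_ray by force
    show "incident S (xs ! 1) (ray q)" using nq by (intro on_q) auto
    have "q + (q + 2) = (q + 1) * 2" by simp
    then have "(q + 1) dvd (q + (q + 2))" by (metis dvd_triv_left)
    then show "incident S (xs ! (q + 2)) (ray q)" using nq q_ge_2 by (intro on_q) auto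
  qed
  then have "cycle_graph (Suc (length ?ys)) \<hookrightarrow> S"
  proof (rule cycle_embeds_if_closed_through_centre)
    show "set ?ys \<subseteq> R" using subR(1) by (auto dest: in_set_takeD in_set_dropD)
    show "set ?ms \<subseteq> link ` R \<union> ray ` {q}"
      using subR(2) by (auto dest: in_set_takeD in_set_dropD)
    show "{q} \<subseteq> {..q}" by simp
    have "xs \<noteq> []" using xs(1) nq by auto
    then have hd: "hd ?ys = xs ! 0" by (cases xs) auto
    have "last ?ys = last xs" using nq q_ge_2 xs(1) by (simp add: last_drop)
    then have last: "last ?ys = xs ! (n + q - 1)"
      using last_conv_nth[OF \<open>xs \<noteq> []\<close>] xs(1) by simp
    have "1 + (n + q - 1) = (q + 1) * (u + 1)" using u by simp
    then have "(q + 1) dvd (1 + (n + q - 1))" by (metis dvd_triv_left)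
    then have "col (last ?ys) = 1" unfolding last using nq q_ge_2 by (intro xs_col) auto
    moreover have "col (hd ?ys) = 0" unfolding hd using nq by (intro xs_col) auto
    ultimately show "col (hd ?ys) \<notin> {q}" "col (last ?ys) \<notin> {q}" "col (hd ?ys) \<noteq> col (last ?ys)"
      using q_ge_2 by auto
  qed
  moreover have "Suc (length ?ys) = n + 1" using nq xs(1) by simp
  ultimately show ?thesis by metis
qed

text \<open>
  Without omissions, the path enters \<open>W t\<close> with colour \<open>t\<close>, having used the rays \<open>1\<close>, ..., \<open>t\<close>;
  \<open>c\<close> is the colour it reaches after \<open>n\<close> points along \<open>rot\<close>. Closing is possible at once for \<open>c > t\<close>.

  For \<open>0 < c \<le> t\<close>, one point of the cycle \<open>W (c - 1)\<close> is omitted. This shifts all later colours by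
  one, so the rays used are \<open>1\<close>, ..., \<open>t + 1\<close> except \<open>c\<close>. The last piece gets one point more and
  starts one colour higher, so it still ends with colour \<open>c\<close>, which is now free.

  For \<open>c = 0\<close> and \<open>t > 0\<close>, the last piece is traversed against \<open>rot\<close>. It then ends with colour \<open>2t\<close>,
  which is free unless it exceeds \<open>q\<close>. In that case, omitting one point and adding one at the end
  moves the final colour to \<open>2t + 2\<close>, which is \<open>e = 2t + 1 - q\<close> modulo \<open>q + 1\<close>; omitting the point in
  \<open>W (e - 1)\<close> keeps ray \<open>e\<close> free.
\<close>

lemma cycle_embeds_along_cycles:
  fixes W :: "nat \<Rightarrow> 'p set"
  assumes W: "\<And>i. i \<le> t \<Longrightarrow> cyclic_on rot (W i) \<and> W i \<subseteq> R"
    and disjoint: "\<And>i j. i \<le> t \<Longrightarrow> j \<le> t \<Longrightarrow> i \<noteq> j \<Longrightarrow> W i \<inter> W j = {}"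
    and t: "t + 2 \<le> q"
    and n: "0 < n" "n \<le> card (W t)"
    and k: "k = (\<Sum>i<t. card (W i)) + n + 1" "3 \<le> k"
  shows "cycle_graph k \<hookrightarrow> S"
proof -
  note close = cycle_embeds_through_cycles[of t W, OF W disjoint]
  have B: "cyclic_on rot (W t)" "W t \<subseteq> R" using W by auto
  note arc = path_along_cycle[OF B]
  obtain v where v: "card (W t) = (q + 1) * v" using dvd_card_cycle[OF B] by (rule dvdE)
  \<comment> \<open>The colours of the connecting rays when ray \<open>e\<close> is skipped.\<close>
  define d where "d e i = (if i < e then i else Suc i)" for e i :: nat
  have d: "d e i < d e (Suc i)" for e i by (simp add: d_def)
  have d_avoids: "e \<notin> d e ` A" for e A by (auto simp: d_def)
  obtain x where x: "x \<in> W t" "col x = t" using point_of_col_in_cycle[OF B, of t] t by auto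
  have xR: "x \<in> R" using x B by auto
  define c where "c = col ((rot ^^ (n - 1)) x)"
  have c: "(c + (n - 1)) mod (q + 1) = t" "c \<le> q"
    using col_rot_iter[OF xR] x(2) col(1)[OF rot_iter_in_R[OF xR]] by (auto simp: c_def)
  consider "t < c" | "0 < c" "c \<le> t" | "c = 0" "t = 0" | "c = 0" "0 < t" "2 * t \<le> q"
    | "c = 0" "0 < t" "q < 2 * t" by linarith
  then show ?thesis
  proof cases
    case 1
    let ?xs = "map (\<lambda>i. (rot ^^ i) x) [0..<n]"
    show ?thesis
    proof (rule close[where d = "\<lambda>i. i" and ys = ?xs])
      show "path S ?xs (map link (butlast ?xs))" "set ?xs \<subseteq> W t"
        "set (map link (butlast ?xs)) \<subseteq> link ` W t" "col (hd ?xs) = t"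
        using arc[OF x(1) n] x(2) by auto
      show "col (last ?xs) \<notin> (\<lambda>i. i) ` {..t}" using arc(6)[OF x(1) n] 1 by (auto simp: c_def)
    qed (use t k in auto)
  next
    case 2
    obtain y where y: "y \<in> W t" "col y = Suc t"
      using point_of_col_in_cycle[OF B, of "Suc t"] t by auto
    have yR: "y \<in> R" using y B by auto
    have mod: "(c + n) mod (q + 1) = Suc t"
    proof -
      have "(c + n) mod (q + 1) = Suc (c + (n - 1)) mod (q + 1)" using n by simp
      also have "\<dots> = Suc t mod (q + 1)" using mod_Suc_eq[of "c + (n - 1)" "q + 1"] c(1) by metis
      finally show ?thesis using t by simp
    qed
    \<comment> \<open>This leaves a point to add to the last piece.\<close>
    have "n \<noteq> card (W t)"
    proof
      assume "n = card (W t)"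
      then have "(c + n) mod (q + 1) = c mod (q + 1)" using v by (simp only: mod_mult_self2)
      then show False using mod c(2) 2 by simp
    qed
    then have n': "0 < n + 1" "n + 1 \<le> card (W t)" using n by auto
    let ?xs = "map (\<lambda>i. (rot ^^ i) y) [0..<n + 1]"
    show ?thesis
    proof (rule close[where d = "d c" and ys = ?xs])
      show "path S ?xs (map link (butlast ?xs))" "set ?xs \<subseteq> W t"
        "set (map link (butlast ?xs)) \<subseteq> link ` W t" "col (hd ?xs) = d c t"
        using arc[OF y(1) n'] y(2) 2 by (auto simp: d_def)
      have "col (last ?xs) = c" using arc(6)[OF y(1) n'] col_rot_iter_eq[OF yR c(2)] mod y(2) by simp
      then show "col (last ?xs) \<notin> d c ` {..t}" using d_avoids by simp
      show "k + d c t = (\<Sum>i<t. card (W i)) + length ?xs + t + 1" using k 2 by (simp add: d_def)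
    qed (use d t 2 in \<open>auto simp: d_def\<close>)
  next
    case 3
    then have "(q + 1) dvd (n - 1)" using c(1) by (simp add: dvd_eq_mod_eq_0)
    then have "cycle_graph (n + 1) \<hookrightarrow> S"
      using n k 3 by (intro cycle_embeds_within_cycle[OF B]) auto
    then show ?thesis using k 3 by simp
  next
    case 4
    obtain y where y: "y \<in> W t" "col y = 2 * t"
      using point_of_col_in_cycle[OF B 4(3)] by auto
    have yR: "y \<in> R" using y B by auto
    have "(t + (n - 1)) mod (q + 1) = (t + (n - 1) mod (q + 1)) mod (q + 1)" by (simp add: mod_add_right_eq)
    also have "\<dots> = 2 * t" using c(1) 4 by simp
    finally have mod: "(t + (n - 1)) mod (q + 1) = 2 * t" .
    \<comment> \<open>The piece is traversed backwards, so \<open>y\<close> is its last point.\<close>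
    let ?xs = "map (\<lambda>i. (rot ^^ i) y) [0..<n]"
    have ne: "?xs \<noteq> []" using n by simp
    show ?thesis
    proof (rule close[where d = "\<lambda>i. i" and ys = "rev ?xs"])
      show "path S (rev ?xs) (rev (map link (butlast ?xs)))"
        using arc(1)[OF y(1) n] by (rule path_rev)
      show "set (rev ?xs) \<subseteq> W t" "set (rev (map link (butlast ?xs))) \<subseteq> link ` W t"
        using arc(2,3)[OF y(1) n] by auto
      show "col (hd (rev ?xs)) = t"
        using arc(6)[OF y(1) n] col_rot_iter_eq[OF yR _ mod[folded y(2)]] t ne by (simp add: hd_rev)
      show "col (last (rev ?xs)) \<notin> (\<lambda>i. i) ` {..t}"
        using arc(5)[OF y(1) n] y(2) ne 4 by (simp add: last_rev)
    qed (use t k in auto)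
  next
    case 5
    define e where "e = 2 * t + 1 - q"
    have e: "0 < e" "e \<le> t" using 5 t by (auto simp: e_def)
    obtain y where y: "y \<in> W t" "col y = e"
      using point_of_col_in_cycle[OF B, of e] e t by auto
    have yR: "y \<in> R" using y B by auto
    have nt: "(n - 1) mod (q + 1) = t" using c(1) 5 by simp
    have "n \<noteq> card (W t)"
    proof
      assume "n = card (W t)"
      then have "n - 1 + 1 = (q + 1) * v" using v n by simp
      then have "(n - 1 + 1) mod (q + 1) = 0" by (simp only: mod_mult_self1_is_0)
      then have "(t + 1) mod (q + 1) = 0" using mod_add_left_eq[of "n - 1" "q + 1" 1] nt by metis
      then show False using t by simp
    qed
    then have n': "0 < n + 1" "n + 1 \<le> card (W t)" using n by auto
    have mod: "(Suc t + (n + 1 - 1)) mod (q + 1) = e"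
    proof -
      have "Suc t + (n + 1 - 1) = t + 2 + (n - 1)" using n by simp
      also have "\<dots> mod (q + 1) = (t + 2 + (n - 1) mod (q + 1)) mod (q + 1)"
        by (rule mod_add_right_eq[symmetric])
      also have "t + 2 + (n - 1) mod (q + 1) = e + (q + 1)" using nt 5 by (simp add: e_def)
      also have "\<dots> mod (q + 1) = e" using e t by (subst mod_add_self2) simp
      finally show ?thesis .
    qed
    let ?xs = "map (\<lambda>i. (rot ^^ i) y) [0..<n + 1]"
    show ?thesis
    proof (rule close[where d = "d e" and ys = "rev ?xs"])
      show "path S (rev ?xs) (rev (map link (butlast ?xs)))"
        using arc(1)[OF y(1) n'] by (rule path_rev)
      show "set (rev ?xs) \<subseteq> W t" "set (rev (map link (butlast ?xs))) \<subseteq> link ` W t"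
        using arc(2,3)[OF y(1) n'] by auto
      show "col (hd (rev ?xs)) = d e t"
        using arc(6)[OF y(1) n'] col_rot_iter_eq[OF yR _ mod[folded y(2)]] t e
        unfolding hd_rev by (simp add: d_def)
      show "col (last (rev ?xs)) \<notin> d e ` {..t}"
        using arc(5)[OF y(1) n'] y(2) d_avoids unfolding last_rev by simp
      show "k + d e t = (\<Sum>i<t. card (W i)) + length (rev ?xs) + t + 1" using k e by (simp add: d_def)
    qed (use d t e in \<open>auto simp: d_def\<close>)
  qed
qed

text \<open>
  Each cycle of \<open>rot\<close> has at least \<open>q + 1\<close> points, so there are at most \<open>q - 1\<close> of them, and the index
  \<open>t\<close> of the last one needed is at most \<open>q - 2\<close>: colours up to \<open>t + 1\<close> do not wrap around.
\<close>

lemma cycle_embeds: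
  assumes k: "3 \<le> k" "k \<le> q^2"
  shows "cycle_graph k \<hookrightarrow> S"
proof -
  obtain C where C: "\<forall>B\<in>C. cyclic_on rot B" "\<Union>C = R" "\<forall>B\<in>C. \<forall>B'\<in>C. B \<noteq> B' \<longrightarrow> B \<inter> B' = {}"
    using permutes_decompose[OF rot finite_R] by blast
  have "finite C" using finite_UnionD C(2) finite_R by blast
  then obtain Bs where Bs: "set Bs = C" "distinct Bs" using finite_distinct_list by blast
  let ?W = "\<lambda>i. Bs ! i" and ?s = "length Bs"
  define N where "N u = (\<Sum>i<u. card (?W i))" for u
  have W: "cyclic_on rot (?W i)" "?W i \<subseteq> R" if "i < ?s" for i
    using C that Bs(1) nth_mem by blast+
  have disjoint: "?W i \<inter> ?W j = {}" if "i < ?s" "j < ?s" "i \<noteq> j" for i j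
    using C(3) Bs that nth_mem by (metis nth_eq_iff_index_eq)
  have "N ?s = card (\<Union>i<?s. ?W i)"
    unfolding N_def using W finite_cycle disjoint by (intro card_UN_disjoint[symmetric]) auto
  also have "(\<Union>i<?s. ?W i) = R" using C(2) Bs(1) by (auto simp: set_conv_nth)
  finally have N: "N ?s = card R" .
  have "?s * (q + 1) = (\<Sum>i<?s. q + 1)" by simp
  also have "\<dots> \<le> N ?s" unfolding N_def using W card_cycle_ge by (intro sum_mono) auto
  also have "\<dots> = (q - 1) * (q + 1)"
    using N card_R q_ge_2 by (cases q) (auto simp: power2_eq_square)
  finally have s: "?s \<le> q - 1" by (simp only: mult_le_cancel2)
  define u where "u = (LEAST u. k - 1 \<le> N u)"
  have Ns: "k - 1 \<le> N ?s" using N card_R k by simp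
  then have u: "k - 1 \<le> N u" "u \<le> ?s"
    unfolding u_def by (rule LeastI, rule Least_le)
  have "u \<noteq> 0" using u(1) k by (cases u) (auto simp: N_def)
  then obtain t where t: "u = Suc t" by (cases u) auto
  have Nt: "N t < k - 1" using not_less_Least[of t "\<lambda>u. k - 1 \<le> N u"] t by (simp add: u_def)
  show ?thesis
  proof (rule cycle_embeds_along_cycles[of t ?W "k - 1 - N t"])
    show "k - 1 - N t \<le> card (?W t)" using u(1) t by (simp add: N_def)
    show "k = (\<Sum>i<t. card (?W i)) + (k - 1 - N t) + 1" using Nt by (simp add: N_def)
  qed (use u t s W disjoint Nt k q_ge_2 in auto)
qed

end


section \<open>Rotations of affine planes\<close>

text \<open>
  In the projective closure, \<open>dir i\<close> is the point of ray \<open>i\<close> on the removed line \<open>m\<close>, so the parallel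
  to ray \<open>i\<close> through \<open>x\<close> is the line joining \<open>x\<close> to \<open>dir i\<close>. The colours \<open>i\<close>, \<open>i - 1\<close> and \<open>i - 2\<close>
  are different as \<open>q + 1 \<ge> 3\<close>. Hence \<open>link x\<close> avoids the centre, for otherwise it would be ray
  \<open>i - 2\<close> and \<open>x\<close> would lie on two rays; and it is not parallel to ray \<open>i - 1\<close>, so that the image of
  \<open>x\<close> is an affine point.
\<close>

lemma affine_plane_rotation:
  fixes A :: "('p, 'l) incidence_structure"
  assumes q: "2 \<le> q" and A: "affine_plane q A"
  shows "\<exists>centre ray col rot link. rotation A q centre ray col rot link"
proof -
  obtain S m where m: "m \<in> lines S" and S: "projective_plane q S" and A_def: "A = remove_line S m"
    using A by (auto simp: affine_plane_def)
  have partial: "partial_plane S" using S by (simp add: projective_plane_def)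
  have cards: "card (points S) = q^2 + q + 1" "card (points_on S m) = q + 1"
    using S m by (auto simp: projective_plane_def)
  have ptsA: "x \<in> points A \<longleftrightarrow> x \<in> points S \<and> \<not> incident S x m" for x
    by (auto simp: A_def remove_line_def points_on_def)
  have linesA: "l \<in> lines A \<longleftrightarrow> l \<in> lines S \<and> l \<noteq> m" for l
    by (auto simp: A_def remove_line_def)
  have incA: "incident A = incident S" by (simp add: A_def remove_line_def)
  have same: "p = r \<or> l = l'"
    if "p \<in> points S" "r \<in> points S" "l \<in> lines S" "l' \<in> lines S"
      "incident S p l" "incident S r l" "incident S p l'" "incident S r l'" for p r l l'
    using partial_plane_unique[OF partial that(1,2) _ that(3-8)] by blast
  have finS: "finite (points S)" using cards(1) by (intro card_ge_0_finite) simp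
  have cardA: "card (points A) = q^2"
  proof -
    have "points A = points S - points_on S m" by (simp add: A_def remove_line_def)
    moreover have "points_on S m \<subseteq> points S" by (auto simp: points_on_def)
    ultimately show ?thesis using cards finS by (simp add: card_Diff_subset finite_subset)
  qed
  then have "points A \<noteq> {}" using q by auto
  then obtain centre where centre: "centre \<in> points A" by blast
  have centre_S: "centre \<in> points S" "\<not> incident S centre m" using centre ptsA by auto
  let ?R = "points A - {centre}"
  have "card (lines_through S centre) = q + 1" using S centre_S by (simp add: projective_plane_def)
  then obtain ray where "bij_betw ray {0..<q + 1} (lines_through S centre)"
    using ex_bij_betw_nat_finite[of "lines_through S centre"] by (metis card.infinite Suc_eq_plus1 nat.distinct(1))
  then have ray_bij: "bij_betw ray {..q} (lines_through S centre)"
    by (simp add: atLeast0LessThan lessThan_Suc_atMost)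
  have ray: "ray i \<in> lines S" "incident S centre (ray i)" if "i \<le> q" for i
    using bij_betwE[OF ray_bij] that by (auto simp: lines_through_def)
  have inj_ray: "inj_on ray {..q}" using ray_bij by (rule bij_betw_imp_inj_on)
  have ray_neq: "ray i \<noteq> ray j" if "i \<le> q" "j \<le> q" "i \<noteq> j" for i j
    using inj_onD[OF inj_ray] that by auto
  have ray_m: "ray i \<noteq> m" if "i \<le> q" for i using ray[OF that] centre_S by auto
  define join where "join p r = (THE l. l \<in> lines S \<and> incident S p l \<and> incident S r l)" for p r
  have join: "join p r \<in> lines S" "incident S p (join p r)" "incident S r (join p r)"
    if "p \<in> points S" "r \<in> points S" "p \<noteq> r" for p r
    using theI'[OF projective_plane_join[OF S that]] by (auto simp: join_def)
  define meet where "meet l l' = (THE p. p \<in> points S \<and> incident S p l \<and> incident S p l')" for l l'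
  have meet: "meet l l' \<in> points S" "incident S (meet l l') l" "incident S (meet l l') l'"
    if "l \<in> lines S" "l' \<in> lines S" "l \<noteq> l'" for l l'
    using theI'[OF projective_plane_meet[OF S that]] by (auto simp: meet_def)
  define dir where "dir i = meet (ray i) m" for i
  have dir: "dir i \<in> points S" "incident S (dir i) (ray i)" "incident S (dir i) m" if "i \<le> q" for i
    using meet[OF ray(1)[OF that] m ray_m[OF that]] by (auto simp: dir_def)
  have dir_inj: "i = j" if "i \<le> q" "j \<le> q" "dir i = dir j" for i j
  proof (rule ccontr)
    assume "i \<noteq> j"
    then have "dir i = centre"
      using same[of "dir i" centre "ray i" "ray j"] dir ray ray_neq centre_S that by metis
    then show False using dir(3)[OF that(1)] centre_S by simp
  qed
  define col where "col x = the_inv_into {..q} ray (join centre x)" for x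
  have col: "col x \<le> q" "incident S x (ray (col x))" if x: "x \<in> ?R" for x
  proof -
    have "join centre x \<in> lines_through S centre"
      using x join centre_S ptsA by (auto simp: lines_through_def)
    then have im: "join centre x \<in> ray ` {..q}" using ray_bij by (simp add: bij_betw_def)
    show "col x \<le> q" using the_inv_into_into[OF inj_ray im order_refl] by (simp add: col_def)
    have "ray (col x) = join centre x" using f_the_inv_into_f[OF inj_ray im] by (simp add: col_def)
    then show "incident S x (ray (col x))" using join(3) x centre_S ptsA by auto
  qed
  have col_eq: "col x = i" if "x \<in> ?R" "i \<le> q" "incident S x (ray i)" for x i
    using same[of x centre "ray (col x)" "ray i"] that col[OF that(1)] ray ray_neq centre_S ptsA
    by (metis Diff_iff insertI1)
  \<comment> \<open>Modulo \<open>q + 1\<close>, the indices are \<open>col x - 2\<close> and \<open>col x - 1\<close>.\<close>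
  define link where "link x = join x (dir ((col x + q - 1) mod (q + 1)))" for x
  define img where "img x = meet (link x) (ray ((col x + q) mod (q + 1)))" for x
  have idx: "(col x + q - 1) mod (q + 1) \<le> q" "(col x + q) mod (q + 1) \<le> q" for x
    using less_Suc_eq_le by force+
  have idx_neq: "(c + q) mod (q + 1) \<noteq> c" "(c + q - 1) mod (q + 1) \<noteq> c"
    "(c + q - 1) mod (q + 1) \<noteq> (c + q) mod (q + 1)" if "c \<le> q" for c
  proof -
    consider "c = 0" | "c = 1" | "2 \<le> c" by linarith
    then have "(c + q) mod (q + 1) \<noteq> c \<and> (c + q - 1) mod (q + 1) \<noteq> c
      \<and> (c + q - 1) mod (q + 1) \<noteq> (c + q) mod (q + 1)"
    proof cases
      case 3
      have "c + q = (c - 1) + (q + 1)" "c + q - 1 = (c - 2) + (q + 1)" using 3 by auto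
      then have "(c + q) mod (q + 1) = c - 1" "(c + q - 1) mod (q + 1) = c - 2"
        using that by (metis mod_add_self2 mod_less less_imp_diff_less le_imp_less_Suc Suc_eq_plus1)+
      then show ?thesis using 3 by linarith
    qed (use q in auto)
    then show "(c + q) mod (q + 1) \<noteq> c" "(c + q - 1) mod (q + 1) \<noteq> c"
      "(c + q - 1) mod (q + 1) \<noteq> (c + q) mod (q + 1)" by auto
  qed
  have link: "link x \<in> lines S" "incident S x (link x)"
    "incident S (dir ((col x + q - 1) mod (q + 1))) (link x)" "link x \<noteq> m" if x: "x \<in> ?R" for x
  proof -
    have "\<not> incident S x m" using x ptsA by blast
    then have neq: "x \<noteq> dir ((col x + q - 1) mod (q + 1))" using dir(3)[OF idx(1), of x] by metis
    show "link x \<in> lines S" "incident S x (link x)"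
      "incident S (dir ((col x + q - 1) mod (q + 1))) (link x)"
      using join[OF _ dir(1)[OF idx(1)] neq] x ptsA by (auto simp: link_def)
    then show "link x \<noteq> m" using x ptsA by auto
  qed
  have centre_link: "\<not> incident S centre (link x)" if x: "x \<in> ?R" for x
  proof
    let ?i = "(col x + q - 1) mod (q + 1)"
    assume "incident S centre (link x)"
    then have "link x = ray ?i"
      using same[of centre "dir ?i" "link x" "ray ?i"] link[OF x] dir[OF idx(1), of x] ray[OF idx(1), of x] centre_S
      by auto
    then have "col x = ?i" using col_eq[OF x idx(1), of x] link(2)[OF x] by simp
    then show False using idx_neq(2)[OF col(1)[OF x]] by simp
  qed
  have link_ray: "link x \<noteq> ray i" if "x \<in> ?R" "i \<le> q" for x i
    using centre_link[OF that(1)] ray(2)[OF that(2)] by auto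
  have dir_link: "i = (col x + q - 1) mod (q + 1)"
    if x: "x \<in> ?R" and i: "i \<le> q" and inc: "incident S (dir i) (link x)" for x i
  proof -
    let ?j = "(col x + q - 1) mod (q + 1)"
    have "dir i = dir ?j"
      using same[of "dir i" "dir ?j" m "link x"] dir[OF i] dir[OF idx(1), of x] link[OF x] m inc by auto
    then show ?thesis using dir_inj i idx(1) by blast
  qed
  have img: "img x \<in> ?R" "incident S (img x) (link x)"
    "incident S (img x) (ray ((col x + q) mod (q + 1)))" if x: "x \<in> ?R" for x
  proof -
    let ?j = "(col x + q) mod (q + 1)"
    have img: "img x \<in> points S" "incident S (img x) (link x)" "incident S (img x) (ray ?j)"
      using meet[OF link(1)[OF x] ray(1)[OF idx(2)] link_ray[OF x idx(2)]] by (auto simp: img_def)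
    have "\<not> incident S (img x) m"
    proof
      assume "incident S (img x) m"
      then have "img x = dir ?j"
        using same[of "img x" "dir ?j" m "ray ?j"] img dir[OF idx(2), of x] ray[OF idx(2), of x]
          ray_m[OF idx(2), of x] m by auto
      then have "?j = (col x + q - 1) mod (q + 1)"
        using dir_link[OF x idx(2)] img(2) by simp
      then show False using idx_neq(3)[OF col(1)[OF x]] by simp
    qed
    moreover have "img x \<noteq> centre" using centre_link[OF x] img(2) by auto
    ultimately show "img x \<in> ?R" "incident S (img x) (link x)" "incident S (img x) (ray ?j)"
      using img ptsA by auto
  qed
  have col_img: "col (img x) = (col x + q) mod (q + 1)" if "x \<in> ?R" for x
    using col_eq[OF img(1)[OF that] idx(2) img(3)[OF that]] .
  have same_ray: "x = y" if "x \<in> ?R" "y \<in> ?R" "link x = link y" "col x = col y" for x y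
    using same[of x y "link x" "ray (col x)"] that link[OF that(1)] link[OF that(2)]
      col[OF that(1)] col[OF that(2)] ray link_ray[OF that(1) col(1)[OF that(1)]] ptsA by auto
  have inj_link: "inj_on link ?R"
  proof (rule inj_onI)
    fix x y assume xy: "x \<in> ?R" "y \<in> ?R" "link x = link y"
    have "(col x + q - 1) mod (q + 1) = (col y + q - 1) mod (q + 1)"
      using dir_link[OF xy(2) idx(1)[of x]] link(3)[OF xy(1)] xy(3) by simp
    then have "col x = col y"
      using residue_eq_if_shift_eq[OF col(1)[OF xy(1)] col(1)[OF xy(2)], of "q - 1"] q by simp
    then show "x = y" using same_ray xy by blast
  qed
  have inj_img: "inj_on img ?R"
  proof (rule inj_onI)
    fix x y assume xy: "x \<in> ?R" "y \<in> ?R" "img x = img y"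
    have col_xy: "col x = col y"
      using residue_eq_if_shift_eq[OF col(1)[OF xy(1)] col(1)[OF xy(2)], of q] col_img xy by metis
    let ?D = "dir ((col x + q - 1) mod (q + 1))"
    have "\<not> incident S (img x) m" using img(1)[OF xy(1)] ptsA by blast
    then have "img x \<noteq> ?D" using dir(3)[OF idx(1), of x] by metis
    moreover have "img x \<in> points S" using img(1)[OF xy(1)] ptsA by blast
    moreover have "incident S (img x) (link y)" using img(2)[OF xy(2)] xy(3) by simp
    moreover have "incident S ?D (link y)" using link(3)[OF xy(2)] col_xy by simp
    ultimately have "link x = link y"
      using same[of "img x" ?D "link x" "link y"] img(2)[OF xy(1)] link(1,3)[OF xy(1)]
        link(1)[OF xy(2)] dir(1)[OF idx(1), of x] by blast
    then show "x = y" using same_ray xy col_xy by blast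
  qed
  have finR: "finite ?R" using finS ptsA by (auto intro: finite_subset)
  define rot where "rot x = (if x \<in> ?R then img x else x)" for x
  have "bij_betw rot ?R ?R"
  proof -
    have "bij_betw img ?R ?R"
      using endo_inj_surj[OF finR _ inj_img] img(1) inj_img by (auto simp: bij_betw_def)
    then show ?thesis by (rule bij_betw_cong[THEN iffD1, rotated]) (simp add: rot_def)
  qed
  then have rot: "rot permutes ?R" by (rule bij_imp_permutes) (auto simp: rot_def)
  have "rotation A q centre ray col rot link"
  proof (unfold_locales)
    show "ray i \<in> lines A" if "i \<le> q" for i using that ray ray_m linesA by auto
    show "incident A centre (ray i)" if "i \<le> q" for i using that ray incA by auto
    show "col x \<le> q" if "x \<in> ?R" for x using that by (rule col)
    show "incident A x (ray (col x))" if "x \<in> ?R" for x using col(2)[OF that] incA by simp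
    show "col (rot x) = (col x + q) mod (q + 1)" if "x \<in> ?R" for x
      using that col_img by (simp add: rot_def)
    show "link x \<in> lines A" if "x \<in> ?R" for x using link[OF that] linesA by simp
    show "incident A x (link x)" if "x \<in> ?R" for x using link[OF that] incA by simp
    show "incident A (rot x) (link x)" if "x \<in> ?R" for x using img[OF that] that incA by (simp add: rot_def)
    show "link x \<noteq> ray i" if "x \<in> ?R" "i \<le> q" for x i using link_ray that by blast
  qed (use q centre cardA inj_ray rot inj_link in auto)
  then show ?thesis by blast
qed

theorem theorem1:
  fixes q k :: nat and \<alpha> :: "('p, 'l) incidence_structure"
  assumes "2 \<le> q" and "affine_plane q \<alpha>" and "3 \<le> k" and "k \<le> q^2"
  shows "cycle_graph k \<hookrightarrow> \<alpha>"
proof -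
  obtain centre ray col rot link where "rotation \<alpha> q centre ray col rot link"
    using affine_plane_rotation[OF assms(1,2)] by blast
  then show ?thesis using assms(3,4) by (rule rotation.cycle_embeds)
qed

end
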